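(* Let $d\ge1$. For each $i\in\{1,\dots,d\}$ let $\mathcal Z_i$ be a finite state space, $M_i$ an irreducible generator on $\mathcal Z_i$ and $\zeta_i\in\mathcal P_+(\mathcal Z_i)$. Define $$\mathcal Z=\prod_{i=1}^d\mathcal Z_i,\qquad \zeta=\zeta_1\otimes\cdots\otimes\zeta_d\in\mathcal P_+(\mathcal Z),\qquad M=\frac1d\sum_{i=1}^d\underbrace{I\otimes\cdots\otimes I}_{i-1}\otimes M_i\otimes\underbrace{I\otimes\cdots\otimes I}_{d-i}\in\mathbb R^{|\mathcal Z|\times|\mathcal Z|}.$$ Then $M$ is an irreducible generator on $\mathcal Z$, and $\zeta$ satisfies the generalised Poincaré and generalised log-Sobolev inequalities with constants $$\alpha_{\mathrm{gPI}}(\zeta,M)=\frac1d\min_{1\le i\le d}\alpha_{\mathrm{gPI}}(\zeta_i,M_i),\qquad \alpha_{\mathrm{gLSI}}(\zeta,M)=\frac1d\min_{1\le i\le d}\alpha_{\mathrm{gLSI}}(\zeta_i,M_i).$$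
   Context: All finite state spaces have at least two elements. A generator on a finite set $\mathcal Z$ is a matrix $M\in\mathbb R^{|\mathcal Z|\times|\mathcal Z|}$ with off-diagonal entries $\ge0$ and rows summing to $0$; reversibility is not assumed. $\mathcal P_+(\mathcal Z)$ is the set of strictly positive probability measures on $\mathcal Z$. $I$ denotes the identity matrix of the appropriate size and $\mathbf 1$ the constant function $1$, with span $\langle\mathbf 1\rangle$. For a finite set $\mathcal Z$, an irreducible generator $M$ on $\mathcal Z$ and $\zeta\in\mathcal P_+(\mathcal Z)$: $\mathbb E_\zeta[f]=\sum_z f(z)\zeta(z)$; $\operatorname{var}_\zeta(f)=\mathbb E_\zeta[f^2]-(\mathbb E_\zeta[f])^2$; $\mathcal D_\zeta(\mathcal Z)=\{\varphi\in\mathbb R^{|\mathcal Z|}:\varphi(z)>0\ \forall z,\ \mathbb E_\zeta[\varphi]=1\}$; $\mathscr H_\zeta(\varphi)=\sum_z\varphi(z)\log\varphi(z)\,\zeta(z)$; $\mathscr E_\zeta(f,M)=\tfrac12\sum_{z,z'}M(z,z')\zeta(z)(f(z)-f(z'))^2$; $\mathscr R_\zeta(\varphi,M)=\sum_{z,z'}M(z,z')\zeta(z)\varphi(z)\bigl[\tfrac{\varphi(z')}{\varphi(z)}-1-\log\tfrac{\varphi(z')}{\varphi(z)}\bigr]$. $\zeta$ satisfies the generalised Poincaré inequality if there is $\alpha>0$ with $\operatorname{var}_\zeta(f)\le\frac1\alpha\mathscr E_\zeta(f,M)$ for all $f\in\mathbb R^{|\mathcal Z|}$, and the generalised log-Sobolev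 inequality if there is $\alpha>0$ with $\mathscr H_\zeta(\varphi)\le\frac1\alpha\mathscr R_\zeta(\varphi,M)$ for all $\varphi\in\mathcal D_\zeta(\mathcal Z)$. The optimal (largest) constants are $$\alpha_{\mathrm{gPI}}(\zeta,M)=\inf_{f\in\mathbb R^{|\mathcal Z|},\,f\notin\langle\mathbf 1\rangle}\frac{\mathscr E_\zeta(f,M)}{\operatorname{var}_\zeta(f)},\qquad \alpha_{\mathrm{gLSI}}(\zeta,M)=\inf_{\varphi\in\mathcal D_\zeta(\mathcal Z),\,\varphi\ne\mathbf 1}\frac{\mathscr R_\zeta(\varphi,M)}{\mathscr H_\zeta(\varphi)}.$$ *)

theory Defs
  imports "HOL-Analysis.Analysis"
begin

text \<open>
  A finite state space is a finite carrier set \<open>Z :: 'a set\<close>.  Elements of \<open>\<real>\<^sup>Z\<close>, weights and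
  matrices are total functions \<open>'a \<Rightarrow> real\<close> and \<open>'a \<Rightarrow> 'a \<Rightarrow> real\<close> of which only the values on \<open>Z\<close>
  are ever used.
\<close>

definition generator :: "'a set \<Rightarrow> ('a \<Rightarrow> 'a \<Rightarrow> real) \<Rightarrow> bool" where
  "generator Z M \<longleftrightarrow>
     (\<forall>x\<in>Z. \<forall>y\<in>Z. x \<noteq> y \<longrightarrow> M x y \<ge> 0) \<and> (\<forall>x\<in>Z. (\<Sum>y\<in>Z. M x y) = 0)"

text \<open>Irreducibility: every state is reachable from every other one along positive rates.\<close>

definition irreducible_on :: "'a set \<Rightarrow> ('a \<Rightarrow> 'a \<Rightarrow> real) \<Rightarrow> bool" where
  "irreducible_on Z M \<longleftrightarrow>
     (\<forall>x\<in>Z. \<forall>y\<in>Z. (x, y) \<in> {(u, v). u \<in> Z \<and> v \<in> Z \<and> M u v > 0}\<^sup>*)"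

definition pos_prob :: "'a set \<Rightarrow> ('a \<Rightarrow> real) set" where
  "pos_prob Z = {\<zeta>. (\<forall>z\<in>Z. \<zeta> z > 0) \<and> (\<Sum>z\<in>Z. \<zeta> z) = 1}"

definition expect :: "'a set \<Rightarrow> ('a \<Rightarrow> real) \<Rightarrow> ('a \<Rightarrow> real) \<Rightarrow> real" where
  "expect Z \<zeta> f = (\<Sum>z\<in>Z. f z * \<zeta> z)"

definition vari :: "'a set \<Rightarrow> ('a \<Rightarrow> real) \<Rightarrow> ('a \<Rightarrow> real) \<Rightarrow> real" where
  "vari Z \<zeta> f = expect Z \<zeta> (\<lambda>z. (f z)\<^sup>2) - (expect Z \<zeta> f)\<^sup>2"

definition densities :: "'a set \<Rightarrow> ('a \<Rightarrow> real) \<Rightarrow> ('a \<Rightarrow> real) set" where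
  "densities Z \<zeta> = {\<phi>. (\<forall>z\<in>Z. \<phi> z > 0) \<and> expect Z \<zeta> \<phi> = 1}"

definition rel_entropy :: "'a set \<Rightarrow> ('a \<Rightarrow> real) \<Rightarrow> ('a \<Rightarrow> real) \<Rightarrow> real" where
  "rel_entropy Z \<zeta> \<phi> = (\<Sum>z\<in>Z. \<phi> z * ln (\<phi> z) * \<zeta> z)"

definition dirichlet_form ::
    "'a set \<Rightarrow> ('a \<Rightarrow> real) \<Rightarrow> ('a \<Rightarrow> real) \<Rightarrow> ('a \<Rightarrow> 'a \<Rightarrow> real) \<Rightarrow> real" where
  "dirichlet_form Z \<zeta> f M =
     (1 / 2) * (\<Sum>z\<in>Z. \<Sum>z'\<in>Z. M z z' * \<zeta> z * (f z - f z')\<^sup>2)"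

definition fisher_info ::
    "'a set \<Rightarrow> ('a \<Rightarrow> real) \<Rightarrow> ('a \<Rightarrow> real) \<Rightarrow> ('a \<Rightarrow> 'a \<Rightarrow> real) \<Rightarrow> real" where
  "fisher_info Z \<zeta> \<phi> M =
     (\<Sum>z\<in>Z. \<Sum>z'\<in>Z. M z z' * \<zeta> z * \<phi> z * (\<phi> z' / \<phi> z - 1 - ln (\<phi> z' / \<phi> z)))"

text \<open>
  The generalised Poincare and log-Sobolev inequalities with a given constant \<open>\<alpha>\<close>; a measure
  satisfies the inequality if such an \<open>\<alpha>\<close> exists.
\<close>

definition gPI :: "'a set \<Rightarrow> ('a \<Rightarrow> real) \<Rightarrow> ('a \<Rightarrow> 'a \<Rightarrow> real) \<Rightarrow> real \<Rightarrow> bool" where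
  "gPI Z \<zeta> M \<alpha> \<longleftrightarrow> \<alpha> > 0 \<and> (\<forall>f. vari Z \<zeta> f \<le> 1 / \<alpha> * dirichlet_form Z \<zeta> f M)"

definition gLSI :: "'a set \<Rightarrow> ('a \<Rightarrow> real) \<Rightarrow> ('a \<Rightarrow> 'a \<Rightarrow> real) \<Rightarrow> real \<Rightarrow> bool" where
  "gLSI Z \<zeta> M \<alpha> \<longleftrightarrow>
     \<alpha> > 0 \<and> (\<forall>\<phi>\<in>densities Z \<zeta>. rel_entropy Z \<zeta> \<phi> \<le> 1 / \<alpha> * fisher_info Z \<zeta> \<phi> M)"

text \<open>
  The infima are taken in \<open>\<real>\<close>.  For a generator on a state space with at least two elements and a
  strictly positive probability measure \<open>\<zeta>\<close> the index sets are nonempty, the quotients are nonnegative and no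
  denominator vanishes, so these are the genuine infima.
\<close>

definition alpha_gPI :: "'a set \<Rightarrow> ('a \<Rightarrow> real) \<Rightarrow> ('a \<Rightarrow> 'a \<Rightarrow> real) \<Rightarrow> real" where
  "alpha_gPI Z \<zeta> M = (INF f\<in>{f. \<not> f constant_on Z}. dirichlet_form Z \<zeta> f M / vari Z \<zeta> f)"

definition alpha_gLSI :: "'a set \<Rightarrow> ('a \<Rightarrow> real) \<Rightarrow> ('a \<Rightarrow> 'a \<Rightarrow> real) \<Rightarrow> real" where
  "alpha_gLSI Z \<zeta> M =
     (INF \<phi>\<in>{\<phi> \<in> densities Z \<zeta>. \<exists>z\<in>Z. \<phi> z \<noteq> 1}. fisher_info Z \<zeta> \<phi> M / rel_entropy Z \<zeta> \<phi>)"

text \<open>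
  A point of \<open>Z\<^sub>1 \<times> \<dots> \<times> Z\<^sub>d\<close> is an extensional function on \<open>{1..d}\<close>.  Accordingly, the tensor
  product of a finite family of matrices has the products of their entries as its entries.
\<close>

definition product_space :: "nat \<Rightarrow> (nat \<Rightarrow> 'a set) \<Rightarrow> (nat \<Rightarrow> 'a) set" where
  "product_space d Z = (\<Pi>\<^sub>E i\<in>{1..d}. Z i)"

definition product_weight :: "nat \<Rightarrow> (nat \<Rightarrow> 'a \<Rightarrow> real) \<Rightarrow> (nat \<Rightarrow> 'a) \<Rightarrow> real" where
  "product_weight d \<zeta> x = (\<Prod>i=1..d. \<zeta> i (x i))"

definition id_matrix :: "'a \<Rightarrow> 'a \<Rightarrow> real" where
  "id_matrix x y = (if x = y then 1 else 0)"

definition tensor_matrix ::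
    "nat \<Rightarrow> (nat \<Rightarrow> 'a \<Rightarrow> 'a \<Rightarrow> real) \<Rightarrow> (nat \<Rightarrow> 'a) \<Rightarrow> (nat \<Rightarrow> 'a) \<Rightarrow> real" where
  "tensor_matrix d A x y = (\<Prod>j=1..d. A j (x j) (y j))"

definition product_generator ::
    "nat \<Rightarrow> (nat \<Rightarrow> 'a \<Rightarrow> 'a \<Rightarrow> real) \<Rightarrow> (nat \<Rightarrow> 'a) \<Rightarrow> (nat \<Rightarrow> 'a) \<Rightarrow> real" where
  "product_generator d M x y =
     (1 / real d) * (\<Sum>i=1..d. tensor_matrix d ((\<lambda>_. id_matrix)(i := M i)) x y)"

end

theory Submission
  imports Defs
begin

text \<open>
  Both inequalities compare a \<open>\<Phi>\<close>-entropy \<open>E[\<Phi>(f)] - \<Phi>(E[f])\<close> with an energy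
  \<open>\<Sum>z z'. \<zeta>(z) M(z,z') G(f(z), f(z'))\<close>: \<open>\<Phi>(u) = u\<^sup>2\<close>, \<open>G(u,v) = (u-v)\<^sup>2/2\<close> for Poincare and
  \<open>\<Phi>(u) = u ln u\<close>, \<open>G(u,v) = u (v/u - 1 - ln (v/u))\<close> for log-Sobolev.  In both cases \<open>G\<close> is jointly
  convex and vanishes on the diagonal, which makes such inequalities tensorize and gives the lower
  bound on the optimal constant; functions of a single coordinate give the upper bound.
  The constants are positive: along a path of positive rates \<open>(f(x) - f(y))\<^sup>2\<close> is controlled by the
  Dirichlet form, and the log-Sobolev case reduces to this one because the Fisher information
  of \<open>f\<close> dominates the Dirichlet form of \<open>\<surd>f\<close>.
\<close>

subsection \<open>Tensorization of entropy inequalities\<close>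

lemma expect_add: "expect Z \<zeta> (\<lambda>z. f z + g z) = expect Z \<zeta> f + expect Z \<zeta> g"
  by (simp add: expect_def sum.distrib algebra_simps)

lemma expect_cmult: "expect Z \<zeta> (\<lambda>z. c * f z) = c * expect Z \<zeta> f"
  by (simp add: expect_def sum_distrib_left algebra_simps)

lemma expect_const: "\<zeta> \<in> pos_prob Z \<Longrightarrow> expect Z \<zeta> (\<lambda>_. c) = c"
  by (simp add: expect_def pos_prob_def flip: sum_distrib_left)

lemma expect_mono:
  assumes "\<zeta> \<in> pos_prob Z" "\<And>z. z \<in> Z \<Longrightarrow> f z \<le> g z"
  shows "expect Z \<zeta> f \<le> expect Z \<zeta> g"
  using assms unfolding expect_def pos_prob_def
  by (intro sum_mono mult_right_mono) (auto simp: less_imp_le)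

lemma expect_cong: "(\<And>z. z \<in> Z \<Longrightarrow> f z = g z) \<Longrightarrow> expect Z \<zeta> f = expect Z \<zeta> g"
  by (simp add: expect_def)

lemma expect_strict_mono:
  assumes "finite Z" "\<zeta> \<in> pos_prob Z" "\<And>z. z \<in> Z \<Longrightarrow> f z \<le> g z" "w \<in> Z" "f w < g w"
  shows "expect Z \<zeta> f < expect Z \<zeta> g"
  using assms unfolding expect_def pos_prob_def
  by (intro sum_strict_mono_ex1) (auto simp: less_imp_le intro!: mult_right_mono bexI[of _ w])

lemma expect_in_convex:
  assumes "finite Z" "\<zeta> \<in> pos_prob Z" "convex D" "f \<in> Z \<rightarrow> D"
  shows "expect Z \<zeta> f \<in> D"
proof -
  have "(\<Sum>z\<in>Z. \<zeta> z *\<^sub>R f z) \<in> D"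
    using assms by (intro convex_sum) (auto simp: pos_prob_def less_imp_le)
  then show ?thesis
    by (simp add: expect_def mult.commute)
qed

lemma expect_pos:
  assumes "finite Z" "\<zeta> \<in> pos_prob Z" "\<And>z. z \<in> Z \<Longrightarrow> 0 < f z"
  shows "0 < expect Z \<zeta> f"
  using expect_in_convex[of Z \<zeta> "{0<..}" f] assms by auto

section \<open>Abstract entropies, energies and their optimal constants\<close>

definition phi_entropy :: "(real \<Rightarrow> real) \<Rightarrow> 'a set \<Rightarrow> ('a \<Rightarrow> real) \<Rightarrow> ('a \<Rightarrow> real) \<Rightarrow> real" where
  "phi_entropy \<Phi> Z \<zeta> f = expect Z \<zeta> (\<lambda>z. \<Phi> (f z)) - \<Phi> (expect Z \<zeta> f)"

definition energy ::
    "(real \<Rightarrow> real \<Rightarrow> real) \<Rightarrow> 'a set \<Rightarrow> ('a \<Rightarrow> real) \<Rightarrow> ('a \<Rightarrow> 'a \<Rightarrow> real) \<Rightarrow> ('a \<Rightarrow> real) \<Rightarrow> real" where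
  "energy G Z \<zeta> M f = expect Z \<zeta> (\<lambda>z. \<Sum>z'\<in>Z. M z z' * G (f z) (f z'))"

text \<open>The energy of \<open>M i\<close> acting on coordinate \<open>i\<close> alone, without
  the factor 1/d. The index set \<open>I\<close> is arbitrary, so that inductions can insert one
  coordinate at a time.\<close>

definition coord_energy ::
    "(real \<Rightarrow> real \<Rightarrow> real) \<Rightarrow> 'i set \<Rightarrow> ('i \<Rightarrow> 'a set) \<Rightarrow> ('i \<Rightarrow> 'a \<Rightarrow> real) \<Rightarrow>
      ('i \<Rightarrow> 'a \<Rightarrow> 'a \<Rightarrow> real) \<Rightarrow> (('i \<Rightarrow> 'a) \<Rightarrow> real) \<Rightarrow> 'i \<Rightarrow> real" where
  "coord_energy G I Z \<zeta> M f i = expect (PiE I Z) (\<lambda>x. \<Prod>j\<in>I. \<zeta> j (x j))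
     (\<lambda>x. \<Sum>b\<in>Z i. M i (x i) b * G (f x) (f (x(i := b))))"

text \<open>Common form of both constants. For the logarithm the infimum runs over all positive
  functions, without normalisation: sections and marginals of a density need not have mean one with
  respect to the remaining coordinates.\<close>

definition optimal_constant ::
    "real set \<Rightarrow> (real \<Rightarrow> real) \<Rightarrow> (real \<Rightarrow> real \<Rightarrow> real) \<Rightarrow>
      'a set \<Rightarrow> ('a \<Rightarrow> real) \<Rightarrow> ('a \<Rightarrow> 'a \<Rightarrow> real) \<Rightarrow> real" where
  "optimal_constant D \<Phi> G Z \<zeta> M =
     (INF f\<in>{f \<in> Z \<rightarrow> D. \<not> f constant_on Z}. energy G Z \<zeta> M f / phi_entropy \<Phi> Z \<zeta> f)"

section \<open>Product measures, Fubini and marginals\<close>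

lemma pos_prob_PiE:
  assumes "finite I" "\<And>i. i \<in> I \<Longrightarrow> finite (Z i)" "\<And>i. i \<in> I \<Longrightarrow> \<zeta> i \<in> pos_prob (Z i)"
  shows "(\<lambda>x. \<Prod>i\<in>I. \<zeta> i (x i)) \<in> pos_prob (PiE I Z)"
proof -
  have "(\<Sum>x\<in>PiE I Z. \<Prod>i\<in>I. \<zeta> i (x i)) = (\<Prod>i\<in>I. \<Sum>a\<in>Z i. \<zeta> i a)"
    using assms by (intro prod_sum_PiE[symmetric])
  also have "\<dots> = 1"
    using assms by (intro prod.neutral) (auto simp: pos_prob_def)
  finally show ?thesis
    using assms(3) by (auto simp: pos_prob_def PiE_iff intro!: prod_pos)
qed

text \<open>Fubini for one coordinate: \<open>(a, x)\<close> maps to \<open>x(k := a)\<close>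
  bijectively onto the larger product, and the weight factorises because \<open>k\<close> lies
  outside \<open>I\<close>.\<close>

lemma expect_PiE_insert:
  assumes "finite I" "k \<notin> I"
  shows "expect (PiE (insert k I) Z) (\<lambda>x. \<Prod>i\<in>insert k I. \<zeta> i (x i)) f =
    expect (Z k) (\<zeta> k) (\<lambda>a. expect (PiE I Z) (\<lambda>x. \<Prod>i\<in>I. \<zeta> i (x i)) (\<lambda>x. f (x(k := a))))"
proof -
  have upd: "(\<Prod>i\<in>I. \<zeta> i ((x(k := a)) i)) = (\<Prod>i\<in>I. \<zeta> i (x i))" for x a
    using assms by (intro prod.cong) auto
  have "expect (PiE (insert k I) Z) (\<lambda>x. \<Prod>i\<in>insert k I. \<zeta> i (x i)) f =
    (\<Sum>(a, x)\<in>Z k \<times> PiE I Z. f (x(k := a)) * (\<Prod>i\<in>insert k I. \<zeta> i ((x(k := a)) i)))"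
    unfolding expect_def PiE_insert_eq using assms
    by (subst sum.reindex[OF inj_combinator]) (auto simp: case_prod_unfold o_def)
  also have "\<dots> = (\<Sum>(a, x)\<in>Z k \<times> PiE I Z. f (x(k := a)) * (\<zeta> k a * (\<Prod>i\<in>I. \<zeta> i (x i))))"
    using assms upd by (intro sum.cong) (auto simp del: fun_upd_apply, simp add: upd)
  also have "\<dots> = (\<Sum>a\<in>Z k. \<Sum>x\<in>PiE I Z. f (x(k := a)) * (\<zeta> k a * (\<Prod>i\<in>I. \<zeta> i (x i))))"
    by (rule sum.cartesian_product[symmetric])
  finally show ?thesis
    by (simp add: expect_def sum_distrib_left mult_ac)
qed

lemma expect_sum: "expect Z \<zeta> (\<lambda>z. \<Sum>s\<in>S. f s z) = (\<Sum>s\<in>S. expect Z \<zeta> (f s))"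
  unfolding expect_def sum_distrib_right by (rule sum.swap)

text \<open>With coordinate \<open>i\<close> split off, the integrand is constant in the others,
  which carry a probability measure.\<close>

lemma expect_PiE_coord:
  assumes "finite I" "i \<in> I" "\<And>j. j \<in> I \<Longrightarrow> finite (Z j)"
    "\<And>j. j \<in> I \<Longrightarrow> \<zeta> j \<in> pos_prob (Z j)"
  shows "expect (PiE I Z) (\<lambda>x. \<Prod>j\<in>I. \<zeta> j (x j)) (\<lambda>x. h (x i)) = expect (Z i) (\<zeta> i) h"
proof -
  have "(\<lambda>x. \<Prod>j\<in>I - {i}. \<zeta> j (x j)) \<in> pos_prob (PiE (I - {i}) Z)"
    using assms by (intro pos_prob_PiE) auto
  then show ?thesis
    using expect_PiE_insert[of "I - {i}" i Z \<zeta> "\<lambda>x. h (x i)"] assms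
    by (simp add: insert_absorb expect_const)
qed

lemma dirichlet_form_eq_energy: "dirichlet_form Z \<zeta> f M = energy (\<lambda>u v. (u - v)\<^sup>2 / 2) Z \<zeta> M f"
  unfolding dirichlet_form_def energy_def expect_def
  by (simp add: sum_distrib_left sum_distrib_right mult_ac)

lemma fisher_info_eq_energy:
  "fisher_info Z \<zeta> f M = energy (\<lambda>u v. u * (v / u - 1 - ln (v / u))) Z \<zeta> M f"
  unfolding fisher_info_def energy_def expect_def
  by (simp add: sum_distrib_left sum_distrib_right mult_ac)

lemma vari_eq_phi_entropy: "vari Z \<zeta> f = phi_entropy (\<lambda>u. u\<^sup>2) Z \<zeta> f"
  by (simp add: vari_def phi_entropy_def)

lemma phi_entropy_const: "\<zeta> \<in> pos_prob Z \<Longrightarrow> f constant_on Z \<Longrightarrow> phi_entropy \<Phi> Z \<zeta> f = 0"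
  by (auto simp: constant_on_def phi_entropy_def expect_const cong: expect_cong)

text \<open>Convexity is stated through supporting lines and planes, so that each Jensen-type bound
  comes from integrating one affine inequality. Strictness for \<open>\<Phi>\<close> keeps the
  denominators of the quotients positive. \<open>G_refl\<close> removes the diagonal rates, whose
  sign is not that of the other rates.\<close>

locale entropy_functional =
  fixes D :: "real set" and \<Phi> :: "real \<Rightarrow> real" and G :: "real \<Rightarrow> real \<Rightarrow> real"
  assumes convex: "convex D"
    and nontrivial: "\<exists>u\<in>D. \<exists>v\<in>D. u \<noteq> v"
    and Phi_tangent: "u \<in> D \<Longrightarrow> \<exists>p. \<forall>v\<in>D. v \<noteq> u \<longrightarrow> \<Phi> u + p * (v - u) < \<Phi> v"
    and G_refl: "G u u = 0"
    and G_nonneg: "u \<in> D \<Longrightarrow> v \<in> D \<Longrightarrow> 0 \<le> G u v"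
    and G_tangent: "u \<in> D \<Longrightarrow> v \<in> D \<Longrightarrow>
      \<exists>p q. \<forall>u'\<in>D. \<forall>v'\<in>D. G u v + p * (u' - u) + q * (v' - v) \<le> G u' v'"
begin

text \<open>Integrate the supporting line of \<open>\<Phi>\<close> at the mean \<open>m\<close>: the
  linear term cancels, and a point with \<open>f w \<noteq> m\<close>, which has positive weight,
  makes the inequality strict.\<close>

lemma entropy_pos:
  assumes "finite Z" "\<zeta> \<in> pos_prob Z" "f \<in> Z \<rightarrow> D" "\<not> f constant_on Z"
  shows "0 < phi_entropy \<Phi> Z \<zeta> f"
proof -
  define m where "m = expect Z \<zeta> f"
  have "m \<in> D"
    unfolding m_def using assms(1-3) convex by (intro expect_in_convex)
  then obtain p where p: "\<And>v. v \<in> D \<Longrightarrow> v \<noteq> m \<Longrightarrow> \<Phi> m + p * (v - m) < \<Phi> v"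
    using Phi_tangent by blast
  obtain w where w: "w \<in> Z" "f w \<noteq> m"
    using assms(4) by (auto simp: constant_on_def)
  have "expect Z \<zeta> (\<lambda>z. (\<Phi> m - p * m) + p * f z) < expect Z \<zeta> (\<lambda>z. \<Phi> (f z))"
  proof (rule expect_strict_mono[OF assms(1,2) _ w(1)])
    show "\<Phi> m - p * m + p * f z \<le> \<Phi> (f z)" if "z \<in> Z" for z
      using p[of "f z"] Pi_mem[OF assms(3) that] by (cases "f z = m") (auto simp: algebra_simps)
    show "\<Phi> m - p * m + p * f w < \<Phi> (f w)"
      using p[of "f w"] Pi_mem[OF assms(3)] w by (auto simp: algebra_simps)
  qed
  then show ?thesis
    using assms(2) by (simp add: expect_add expect_cmult expect_const phi_entropy_def flip: m_def)
qed

lemma entropy_nonneg: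
  assumes "finite Z" "\<zeta> \<in> pos_prob Z" "f \<in> Z \<rightarrow> D"
  shows "0 \<le> phi_entropy \<Phi> Z \<zeta> f"
  using entropy_pos[OF assms] phi_entropy_const[OF assms(2)] by (cases "f constant_on Z") force+

text \<open>Integrating the supporting plane of \<open>G\<close> at the pair of means cancels both
  linear terms.\<close>

lemma jensen:
  assumes "finite S" "w \<in> pos_prob S" "f \<in> S \<rightarrow> D" "g \<in> S \<rightarrow> D"
  shows "G (expect S w f) (expect S w g) \<le> expect S w (\<lambda>s. G (f s) (g s))"
proof -
  define u v where "u = expect S w f" and "v = expect S w g"
  have "u \<in> D" "v \<in> D"
    unfolding u_def v_def using assms convex by (auto intro: expect_in_convex)
  then obtain p q where pq: "\<And>u' v'. u' \<in> D \<Longrightarrow> v' \<in> D \<Longrightarrow>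
      G u v + p * (u' - u) + q * (v' - v) \<le> G u' v'"
    using G_tangent by blast
  have "expect S w (\<lambda>s. (G u v - p * u - q * v) + (p * f s + q * g s)) \<le> expect S w (\<lambda>s. G (f s) (g s))"
  proof (rule expect_mono[OF assms(2)])
    show "(G u v - p * u - q * v) + (p * f s + q * g s) \<le> G (f s) (g s)" if "s \<in> S" for s
      using pq[of "f s" "g s"] assms(3,4) that by (auto simp: algebra_simps)
  qed
  then show ?thesis
    using assms(2) by (simp add: expect_add expect_cmult expect_const flip: u_def v_def)
qed

lemma energy_nonneg:
  assumes "generator Z M" "\<zeta> \<in> pos_prob Z" "f \<in> Z \<rightarrow> D"
  shows "0 \<le> energy G Z \<zeta> M f"
proof -
  have "0 \<le> M z z' * G (f z) (f z')" if "z \<in> Z" "z' \<in> Z" for z z'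
    using assms that by (cases "z = z'") (auto simp: G_refl generator_def intro!: mult_nonneg_nonneg G_nonneg)
  then show ?thesis
    using expect_mono[OF assms(2), of "\<lambda>_. 0"] assms(2)
    by (simp add: energy_def expect_const sum_nonneg)
qed

lemma energy_const: "f constant_on Z \<Longrightarrow> energy G Z \<zeta> M f = 0"
  by (auto simp: constant_on_def energy_def expect_def G_refl)

lemma optimal_constant_le:
  assumes "finite Z" "generator Z M" "\<zeta> \<in> pos_prob Z" "f \<in> Z \<rightarrow> D"
  shows "optimal_constant D \<Phi> G Z \<zeta> M * phi_entropy \<Phi> Z \<zeta> f \<le> energy G Z \<zeta> M f"
proof (cases "f constant_on Z")
  case True
  then show ?thesis
    using assms by (simp add: phi_entropy_const energy_const)
next
  case False
  \<comment> \<open>A real infimum is known to be a lower bound only for a set bounded below; here 0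
    is a bound.\<close>
  have "bdd_below ((\<lambda>f. energy G Z \<zeta> M f / phi_entropy \<Phi> Z \<zeta> f) ` {f \<in> Z \<rightarrow> D. \<not> f constant_on Z})"
    using assms by (intro bdd_belowI[of _ 0]) (auto intro!: divide_nonneg_nonneg energy_nonneg entropy_nonneg)
  then have "optimal_constant D \<Phi> G Z \<zeta> M \<le> energy G Z \<zeta> M f / phi_entropy \<Phi> Z \<zeta> f"
    unfolding optimal_constant_def using False assms(4) by (intro cINF_lower) auto
  then show ?thesis
    using entropy_pos[OF assms(1,3,4) False] by (simp add: pos_le_divide_eq)
qed

lemma le_optimal_constant:
  assumes "finite Z" "card Z \<ge> 2" "\<zeta> \<in> pos_prob Z"
    and "\<And>f. f \<in> Z \<rightarrow> D \<Longrightarrow> c * phi_entropy \<Phi> Z \<zeta> f \<le> energy G Z \<zeta> M f"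
  shows "c \<le> optimal_constant D \<Phi> G Z \<zeta> M"
proof -
  obtain u v where uv: "u \<in> D" "v \<in> D" "u \<noteq> v"
    using nontrivial by blast
  obtain z w where zw: "z \<in> Z" "w \<in> Z" "z \<noteq> w"
    using assms(2) by (metis card_2_iff' ex_card subset_eq)
  \<comment> \<open>A nonconstant function exists, so the infimum is over a nonempty set.\<close>
  have "(\<lambda>x. if x = z then u else v) \<in> {f \<in> Z \<rightarrow> D. \<not> f constant_on Z}"
    using uv zw by (auto simp: constant_on_def) metis
  then show ?thesis
    unfolding optimal_constant_def
    by (intro cINF_greatest) (use assms in \<open>auto simp: pos_le_divide_eq entropy_pos\<close>)
qed

text \<open>The chain rule splits the entropy into the averaged entropy over \<open>I\<close> and the entropy of the
  marginal in direction \<open>k\<close>; joint convexity of \<open>G\<close> bounds the energy of that marginal by the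
  averaged energy in direction \<open>k\<close>.\<close>

lemma tensorization:
  assumes "finite I" "\<And>i. i \<in> I \<Longrightarrow> finite (Z i)" "\<And>i. i \<in> I \<Longrightarrow> \<zeta> i \<in> pos_prob (Z i)"
    and "\<And>i. i \<in> I \<Longrightarrow> generator (Z i) (M i)"
    and "\<And>i f. i \<in> I \<Longrightarrow> f \<in> Z i \<rightarrow> D \<Longrightarrow>
      c * phi_entropy \<Phi> (Z i) (\<zeta> i) f \<le> energy G (Z i) (\<zeta> i) (M i) f"
    and "f \<in> PiE I Z \<rightarrow> D"
  shows "c * phi_entropy \<Phi> (PiE I Z) (\<lambda>x. \<Prod>i\<in>I. \<zeta> i (x i)) f \<le> (\<Sum>i\<in>I. coord_energy G I Z \<zeta> M f i)"
  using assms
proof (induction I arbitrary: f rule: finite_induct)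
  case empty
  \<comment> \<open>The product over no coordinates is a single point of weight 1, so the entropy
    vanishes.\<close>
  show ?case by (simp add: phi_entropy_def expect_def)
next
  case (insert k I)
  let ?E = "expect (PiE I Z) (\<lambda>x. \<Prod>i\<in>I. \<zeta> i (x i))"
  let ?EE = "expect (PiE (insert k I) Z) (\<lambda>x. \<Prod>i\<in>insert k I. \<zeta> i (x i))"
  let ?Ek = "expect (Z k) (\<zeta> k)"
  define F where "F = (\<lambda>a. ?E (\<lambda>x. f (x(k := a))))"
  have EE: "?EE h = ?Ek (\<lambda>a. ?E (\<lambda>x. h (x(k := a))))" for h
    by (rule expect_PiE_insert) fact+
  have pp: "(\<lambda>x. \<Prod>i\<in>I. \<zeta> i (x i)) \<in> pos_prob (PiE I Z)"
    using insert by (intro pos_prob_PiE) auto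
  have fin: "finite (PiE I Z)"
    using insert by (intro finite_PiE) auto
  have k: "finite (Z k)" "\<zeta> k \<in> pos_prob (Z k)" "generator (Z k) (M k)"
    using insert.prems by auto
  have fk: "(\<lambda>x. f (x(k := a))) \<in> PiE I Z \<rightarrow> D" if "a \<in> Z k" for a
    using insert.prems(5) that by (fastforce simp: PiE_insert_eq)
  have F: "F \<in> Z k \<rightarrow> D"
    unfolding F_def using expect_in_convex[OF fin pp convex] fk by auto
  have chain: "phi_entropy \<Phi> (PiE (insert k I) Z) (\<lambda>x. \<Prod>i\<in>insert k I. \<zeta> i (x i)) f =
      ?Ek (\<lambda>a. phi_entropy \<Phi> (PiE I Z) (\<lambda>x. \<Prod>i\<in>I. \<zeta> i (x i)) (\<lambda>x. f (x(k := a)))) +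
      phi_entropy \<Phi> (Z k) (\<zeta> k) F"
    unfolding phi_entropy_def EE F_def
    by (simp add: expect_def left_diff_distrib sum_subtractf)
  have "c * ?Ek (\<lambda>a. phi_entropy \<Phi> (PiE I Z) (\<lambda>x. \<Prod>i\<in>I. \<zeta> i (x i)) (\<lambda>x. f (x(k := a)))) \<le>
      ?Ek (\<lambda>a. \<Sum>i\<in>I. coord_energy G I Z \<zeta> M (\<lambda>x. f (x(k := a))) i)"
    unfolding expect_cmult[symmetric]
    by (intro expect_mono k insert.IH[OF _ _ _ _ fk]) (use insert.prems in auto)
  also have "\<dots> = (\<Sum>i\<in>I. ?Ek (\<lambda>a. coord_energy G I Z \<zeta> M (\<lambda>x. f (x(k := a))) i))"
    by (rule expect_sum)
  also have "\<dots> = (\<Sum>i\<in>I. coord_energy G (insert k I) Z \<zeta> M f i)"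
  proof (rule sum.cong[OF refl])
    fix i assume "i \<in> I"
    then have "i \<noteq> k" using insert.hyps by auto
    then show "?Ek (\<lambda>a. coord_energy G I Z \<zeta> M (\<lambda>x. f (x(k := a))) i) = coord_energy G (insert k I) Z \<zeta> M f i"
      unfolding coord_energy_def EE by (simp add: fun_upd_twist)
  qed
  finally have 1: "c * ?Ek (\<lambda>a. phi_entropy \<Phi> (PiE I Z) (\<lambda>x. \<Prod>i\<in>I. \<zeta> i (x i)) (\<lambda>x. f (x(k := a)))) \<le>
      (\<Sum>i\<in>I. coord_energy G (insert k I) Z \<zeta> M f i)" .
  have "c * phi_entropy \<Phi> (Z k) (\<zeta> k) F \<le> energy G (Z k) (\<zeta> k) (M k) F"
    using insert.prems(4) F by auto
  also have "\<dots> \<le> ?Ek (\<lambda>a. \<Sum>b\<in>Z k. M k a b * ?E (\<lambda>x. G (f (x(k := a))) (f (x(k := b)))))"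
    unfolding energy_def
  proof (intro expect_mono k sum_mono)
    fix a b assume ab: "a \<in> Z k" "b \<in> Z k"
    \<comment> \<open>Jensen may be multiplied by an off-diagonal rate. A diagonal rate may be
      negative, but there both sides are 0.\<close>
    show "M k a b * G (F a) (F b) \<le> M k a b * ?E (\<lambda>x. G (f (x(k := a))) (f (x(k := b))))"
    proof (cases "a = b")
      case True
      then show ?thesis using pp by (simp add: G_refl expect_const)
    next
      case False
      then show ?thesis
        unfolding F_def using ab k jensen[OF fin pp fk fk]
        by (intro mult_left_mono) (auto simp: generator_def)
    qed
  qed
  also have "\<dots> = coord_energy G (insert k I) Z \<zeta> M f k"
    unfolding coord_energy_def EE by (simp add: expect_sum expect_cmult)
  finally show ?case
    unfolding chain using 1 insert.hyps by (simp add: distrib_left)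
qed

end

subsection \<open>The product generator\<close>

text \<open>Every identity factor forces agreement of \<open>x\<close> and \<open>y\<close> in its
  coordinate, so the only surviving entries change at most coordinate \<open>i\<close>.\<close>

lemma tensor_matrix_coord:
  assumes "i \<in> {1..d}" "x \<in> PiE {1..d} Z" "y \<in> PiE {1..d} Z"
  shows "tensor_matrix d ((\<lambda>_. id_matrix)(i := A)) x y = (if y = x(i := y i) then A (x i) (y i) else 0)"
proof -
  have eq: "tensor_matrix d ((\<lambda>_. id_matrix)(i := A)) x y =
      A (x i) (y i) * (\<Prod>j\<in>{1..d} - {i}. id_matrix (x j) (y j))"
    unfolding tensor_matrix_def using assms(1) by (subst prod.remove[of _ i]) (auto intro!: prod.cong)
  show ?thesis
  proof (cases "y = x(i := y i)")
    case True
    then have "\<forall>j\<in>{1..d} - {i}. id_matrix (x j) (y j) = 1"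
      by (metis DiffD2 fun_upd_other id_matrix_def insertI1)
    then show ?thesis
      using True by (simp add: eq)
  next
    case False
    then obtain j where j: "j \<noteq> i" "x j \<noteq> y j"
      by (metis fun_upd_idem_iff fun_upd_other fun_upd_same ext)
    \<comment> \<open>Points of the product are extensional and agree outside
      \<open>{1..d}\<close>.\<close>
    then have "j \<in> {1..d}"
      using assms(2,3) by (metis PiE_arb)
    then have "(\<Prod>j\<in>{1..d} - {i}. id_matrix (x j) (y j)) = 0"
      using j by (intro prod_zero) (auto simp: id_matrix_def)
    then show ?thesis
      using False by (simp add: eq)
  qed
qed

lemma PiE_fun_upd_mem: "x \<in> PiE I Z \<Longrightarrow> i \<in> I \<Longrightarrow> b \<in> Z i \<Longrightarrow> x(i := b) \<in> PiE I Z"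
  by (auto simp: PiE_iff extensional_def)

text \<open>Reduces a row of the product matrix to moves in a single coordinate. Taking
  \<open>h\<close> constantly 1 gives the row sums, and \<open>h y = G (f x) (f y)\<close> gives the
  energy.\<close>

lemma product_generator_action:
  assumes "\<And>i. i \<in> {1..d} \<Longrightarrow> finite (Z i)" "x \<in> PiE {1..d} Z"
  shows "(\<Sum>y\<in>PiE {1..d} Z. product_generator d M x y * h y) =
    (1 / real d) * (\<Sum>i=1..d. \<Sum>b\<in>Z i. M i (x i) b * h (x(i := b)))"
proof -
  have fin: "finite (PiE {1..d} Z)"
    using assms by (intro finite_PiE) auto
  have coord: "(\<Sum>y\<in>PiE {1..d} Z. tensor_matrix d ((\<lambda>_. id_matrix)(i := M i)) x y * h y) =
      (\<Sum>b\<in>Z i. M i (x i) b * h (x(i := b)))" if i: "i \<in> {1..d}" for i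
  proof -
    have "(\<Sum>y\<in>PiE {1..d} Z. tensor_matrix d ((\<lambda>_. id_matrix)(i := M i)) x y * h y) =
        (\<Sum>y\<in>(\<lambda>b. x(i := b)) ` Z i. M i (x i) (y i) * h y)"
    proof (rule sum.mono_neutral_cong_right[OF fin])
      show "(\<lambda>b. x(i := b)) ` Z i \<subseteq> PiE {1..d} Z"
        using assms(2) i by (auto intro: PiE_fun_upd_mem)
      show "\<forall>y\<in>PiE {1..d} Z - (\<lambda>b. x(i := b)) ` Z i.
          tensor_matrix d ((\<lambda>_. id_matrix)(i := M i)) x y * h y = 0"
      proof
        fix y assume y: "y \<in> PiE {1..d} Z - (\<lambda>b. x(i := b)) ` Z i"
        then have "y i \<in> Z i" using i by auto
        then have "y \<noteq> x(i := y i)" using y by blast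
        then show "tensor_matrix d ((\<lambda>_. id_matrix)(i := M i)) x y * h y = 0"
          using y by (simp add: tensor_matrix_coord[OF i assms(2)])
      qed
      fix y assume "y \<in> (\<lambda>b. x(i := b)) ` Z i"
      then show "tensor_matrix d ((\<lambda>_. id_matrix)(i := M i)) x y * h y = M i (x i) (y i) * h y"
        using PiE_fun_upd_mem[OF assms(2) i] by (auto simp: tensor_matrix_coord[OF i assms(2)])
    qed
    also have "\<dots> = (\<Sum>b\<in>Z i. M i (x i) b * h (x(i := b)))"
      by (subst sum.reindex) (auto intro!: inj_onI dest: fun_upd_eqD)
    finally show ?thesis .
  qed
  have "(\<Sum>y\<in>PiE {1..d} Z. product_generator d M x y * h y) = (1 / real d) *
      (\<Sum>i=1..d. \<Sum>y\<in>PiE {1..d} Z. tensor_matrix d ((\<lambda>_. id_matrix)(i := M i)) x y * h y)"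
    unfolding product_generator_def
    by (subst sum.swap) (simp add: sum_distrib_left sum_distrib_right mult_ac)
  also have "\<dots> = (1 / real d) * (\<Sum>i=1..d. \<Sum>b\<in>Z i. M i (x i) b * h (x(i := b)))"
    using coord by simp
  finally show ?thesis .
qed

lemma generator_product:
  assumes "\<And>i. i \<in> {1..d} \<Longrightarrow> finite (Z i)" "\<And>i. i \<in> {1..d} \<Longrightarrow> generator (Z i) (M i)"
  shows "generator (PiE {1..d} Z) (product_generator d M)"
  unfolding generator_def
proof (intro conjI ballI impI)
  fix x y assume xy: "x \<in> PiE {1..d} Z" "y \<in> PiE {1..d} Z" "x \<noteq> y"
  have "0 \<le> tensor_matrix d ((\<lambda>_. id_matrix)(i := M i)) x y" if i: "i \<in> {1..d}" for i
  proof (cases "y = x(i := y i)")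
    case True
    \<comment> \<open>Since \<open>x\<close> and \<open>y\<close> differ only at \<open>i\<close>,
      the entry of \<open>M i\<close> is off the diagonal and hence nonnegative.\<close>
    then have "x i \<noteq> y i" using xy(3) by (metis fun_upd_triv)
    moreover have "x i \<in> Z i" "y i \<in> Z i" using xy i by auto
    ultimately have "0 \<le> M i (x i) (y i)"
      using assms(2)[OF i] by (simp add: generator_def)
    then show ?thesis
      by (simp add: tensor_matrix_coord[OF i xy(1,2)])
  next
    case False
    then show ?thesis by (simp add: tensor_matrix_coord[OF i xy(1,2)])
  qed
  then show "0 \<le> product_generator d M x y"
    unfolding product_generator_def by (intro mult_nonneg_nonneg sum_nonneg) auto
next
  fix x assume x: "x \<in> PiE {1..d} Z"
  have "(\<Sum>b\<in>Z i. M i (x i) b) = 0" if "i \<in> {1..d}" for i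
    using assms(2)[OF that] x that by (auto simp: generator_def)
  then show "(\<Sum>y\<in>PiE {1..d} Z. product_generator d M x y) = 0"
    using product_generator_action[OF assms(1) x, of M "\<lambda>_. 1"] by simp
qed

text \<open>A genuine change of coordinate \<open>i\<close> is seen by the \<open>i\<close>-th
  summand only; for \<open>b = x i\<close> the entry would be diagonal and collect a contribution
  from every summand.\<close>

lemma product_generator_coord:
  assumes "i \<in> {1..d}" "x \<in> PiE {1..d} Z" "b \<in> Z i" "b \<noteq> x i"
  shows "product_generator d M x (x(i := b)) = M i (x i) b / real d"
proof -
  have y: "x(i := b) \<in> PiE {1..d} Z"
    using assms by (intro PiE_fun_upd_mem)
  have "tensor_matrix d ((\<lambda>_. id_matrix)(j := M j)) x (x(i := b)) = (if j = i then M i (x i) b else 0)"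
    if "j \<in> {1..d}" for j
  proof (cases "j = i")
    case False
    then have "x(i := b) \<noteq> x(j := (x(i := b)) j)"
      using assms(4) by (metis fun_upd_other fun_upd_same fun_upd_triv)
    then show ?thesis
      using False tensor_matrix_coord[OF that assms(2) y] by simp
  qed (use tensor_matrix_coord[OF that assms(2) y] in simp)
  then show ?thesis
    unfolding product_generator_def using assms(1) by simp
qed

text \<open>Coordinates are moved to their targets one after another, each along a path of positive
  rates of its own generator while the others stay fixed.\<close>

lemma irreducible_product:
  assumes "\<And>i. i \<in> {1..d} \<Longrightarrow> irreducible_on (Z i) (M i)"
  shows "irreducible_on (PiE {1..d} Z) (product_generator d M)"
proof -
  define P where "P = PiE {1..d} Z"
  define R where "R = {(u, v). u \<in> P \<and> v \<in> P \<and> product_generator d M u v > 0}"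
  have step: "(x, x(i := b)) \<in> R\<^sup>*" if x: "x \<in> P" and i: "i \<in> {1..d}" and b: "b \<in> Z i" for x i b
  proof -
    have "x i \<in> Z i" using x i by (auto simp: P_def)
    then have "(x i, b) \<in> {(u, v). u \<in> Z i \<and> v \<in> Z i \<and> M i u v > 0}\<^sup>*"
      using assms[OF i] b by (auto simp: irreducible_on_def)
    then show ?thesis
    proof (induction rule: rtrancl_induct)
      case base
      show ?case by simp
    next
      case (step b c)
      have bP: "x(i := b) \<in> P" and cP: "x(i := c) \<in> P"
        using step.hyps(2) x i unfolding P_def by (auto intro: PiE_fun_upd_mem)
      have "(x(i := b), x(i := c)) \<in> R\<^sup>*"
      \<comment> \<open>A loop in the coordinate path would be a diagonal entry of the product; it
        is skipped, as nothing has to move.\<close>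
      proof (cases "b = c")
        case False
        have "product_generator d M (x(i := b)) ((x(i := b))(i := c)) = M i b c / real d"
          using product_generator_coord[of i d "x(i := b)" Z c M] i bP False step.hyps(2)
          by (auto simp: P_def)
        then have "product_generator d M (x(i := b)) (x(i := c)) > 0"
          using step.hyps(2) i by auto
        then show ?thesis
          using bP cP by (auto simp: R_def)
      qed simp
      with step.IH show ?case by (rule rtrancl_trans)
    qed
  qed
  have "(x, y) \<in> R\<^sup>*" if x: "x \<in> P" and y: "y \<in> P" for x y
  proof -
    \<comment> \<open>\<open>override_on x y J\<close> is the intermediate point whose coordinates
      in \<open>J\<close> have already been moved to those of \<open>y\<close>.\<close>
    have ov: "override_on x y J \<in> P \<and> (x, override_on x y J) \<in> R\<^sup>*" if "J \<subseteq> {1..d}" for J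
      using finite_subset[OF that finite_atLeastAtMost] that
    proof (induction J rule: finite_induct)
      case empty
      then show ?case using x by simp
    next
      case (insert j J)
      then have j: "j \<in> {1..d}" "y j \<in> Z j" and IH: "override_on x y J \<in> P" "(x, override_on x y J) \<in> R\<^sup>*"
        using y by (auto simp: P_def)
      have "(override_on x y J, (override_on x y J)(j := y j)) \<in> R\<^sup>*"
        by (rule step[OF IH(1) j])
      from rtrancl_trans[OF IH(2) this] PiE_fun_upd_mem[OF IH(1)[unfolded P_def] j]
      show ?case
        unfolding override_on_insert P_def by (rule conjI[rotated])
    qed
    have "override_on x y {1..d} = y"
    proof
      fix i
      show "override_on x y {1..d} i = y i"
        using x[unfolded P_def, THEN PiE_arb] y[unfolded P_def, THEN PiE_arb]
        by (cases "i \<in> {1..d}") simp_all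
    qed
    then show ?thesis using ov[of "{1..d}"] by simp
  qed
  then show ?thesis
    unfolding irreducible_on_def R_def P_def by blast
qed

section \<open>Energy and optimal constant on the product\<close>

lemma energy_product:
  assumes "\<And>i. i \<in> {1..d} \<Longrightarrow> finite (Z i)"
  shows "energy G (PiE {1..d} Z) (\<lambda>x. \<Prod>i=1..d. \<zeta> i (x i)) (product_generator d M) f =
    (1 / real d) * (\<Sum>i=1..d. coord_energy G {1..d} Z \<zeta> M f i)"
proof -
  have "energy G (PiE {1..d} Z) (\<lambda>x. \<Prod>i=1..d. \<zeta> i (x i)) (product_generator d M) f =
    expect (PiE {1..d} Z) (\<lambda>x. \<Prod>i=1..d. \<zeta> i (x i))
      (\<lambda>x. (1 / real d) * (\<Sum>i=1..d. \<Sum>b\<in>Z i. M i (x i) b * G (f x) (f (x(i := b)))))"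
    unfolding energy_def using assms
    by (intro expect_cong product_generator_action) auto
  then show ?thesis
    by (simp only: expect_cmult expect_sum[where f = "\<lambda>i x. \<Sum>b\<in>Z i. M i (x i) b * G (f x) (f (x(i := b)))"]
        coord_energy_def)
qed

lemma card_PiE_ge_2:
  assumes "d \<ge> 1" "\<And>i. i \<in> {1..d} \<Longrightarrow> card (Z i) \<ge> 2"
  shows "card (PiE {1..d::nat} Z) \<ge> 2"
proof -
  have "1 \<le> (\<Prod>i\<in>{1..d} - {1}. card (Z i))"
    using assms(2) by (intro prod_ge_1) force
  moreover have "card (PiE {1..d} Z) = card (Z 1) * (\<Prod>i\<in>{1..d} - {1}. card (Z i))"
    using assms(1) by (simp add: card_PiE prod.remove[of _ 1])
  ultimately show ?thesis
    using mult_le_mono[OF assms(2)[of 1], of 1 "\<Prod>i\<in>{1..d} - {1}. card (Z i)"] assms(1) by simp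
qed

context entropy_functional
begin

lemma optimal_constant_product:
  assumes d: "d \<ge> 1"
    and Z: "\<And>i. i \<in> {1..d} \<Longrightarrow> finite (Z i)" "\<And>i. i \<in> {1..d} \<Longrightarrow> card (Z i) \<ge> 2"
    and M: "\<And>i. i \<in> {1..d} \<Longrightarrow> generator (Z i) (M i)"
    and \<zeta>: "\<And>i. i \<in> {1..d} \<Longrightarrow> \<zeta> i \<in> pos_prob (Z i)"
  shows "optimal_constant D \<Phi> G (product_space d Z) (product_weight d \<zeta>) (product_generator d M) =
    (1 / real d) * (MIN i\<in>{1..d}. optimal_constant D \<Phi> G (Z i) (\<zeta> i) (M i))"
proof -
  let ?P = "PiE {1..d} Z"
  let ?W = "\<lambda>x. \<Prod>i=1..d. \<zeta> i (x i)"
  let ?\<alpha> = "\<lambda>i. optimal_constant D \<Phi> G (Z i) (\<zeta> i) (M i)"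
  let ?A = "optimal_constant D \<Phi> G ?P ?W (product_generator d M)"
  define c where "c = (MIN i\<in>{1..d}. ?\<alpha> i)"
  have fin: "finite ?P"
    using Z by (intro finite_PiE) auto
  have pp: "?W \<in> pos_prob ?P"
    using Z \<zeta> by (intro pos_prob_PiE) auto
  have gen: "generator ?P (product_generator d M)"
    using Z M by (intro generator_product)
  have en: "energy G ?P ?W (product_generator d M) f =
      (1 / real d) * (\<Sum>i=1..d. coord_energy G {1..d} Z \<zeta> M f i)" for f
    by (rule energy_product[where Z = Z and \<zeta> = \<zeta> and M = M and G = G and f = f, OF Z(1)])
  have "c / real d \<le> ?A"
  proof (rule le_optimal_constant[OF fin card_PiE_ge_2[OF d Z(2)] pp])
    fix f assume f: "f \<in> ?P \<rightarrow> D"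
    have "c * phi_entropy \<Phi> ?P ?W f \<le> (\<Sum>i=1..d. coord_energy G {1..d} Z \<zeta> M f i)"
    proof (rule tensorization)
      fix i g assume i: "i \<in> {1..d}" and g: "g \<in> Z i \<rightarrow> D"
      have "c \<le> ?\<alpha> i"
        unfolding c_def using i by (intro Min_le) auto
      then have "c * phi_entropy \<Phi> (Z i) (\<zeta> i) g \<le> ?\<alpha> i * phi_entropy \<Phi> (Z i) (\<zeta> i) g"
        using entropy_nonneg[OF Z(1)[OF i] \<zeta>[OF i] g] by (rule mult_right_mono)
      also have "\<dots> \<le> energy G (Z i) (\<zeta> i) (M i) g"
        using i g by (intro optimal_constant_le Z M \<zeta>)
      finally show "c * phi_entropy \<Phi> (Z i) (\<zeta> i) g \<le> energy G (Z i) (\<zeta> i) (M i) g" .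
    qed (use Z M \<zeta> f in auto)
    then show "c / real d * phi_entropy \<Phi> ?P ?W f \<le> energy G ?P ?W (product_generator d M) f"
      unfolding en using d by (simp add: divide_right_mono)
  qed
  moreover have "?A \<le> c / real d"
  proof -
    have "real d * ?A \<le> ?\<alpha> i" if i: "i \<in> {1..d}" for i
    proof (rule le_optimal_constant[OF Z(1,2)[OF i] \<zeta>[OF i]])
      fix g assume g: "g \<in> Z i \<rightarrow> D"
      let ?f = "\<lambda>x. g (x i)"
      have f: "?f \<in> ?P \<rightarrow> D"
        using g i by (auto simp: PiE_iff Pi_iff)
      have marginal: "expect ?P ?W (\<lambda>x. h (x i)) = expect (Z i) (\<zeta> i) h" for h
        using i Z \<zeta> by (intro expect_PiE_coord) auto
      have ent: "phi_entropy \<Phi> ?P ?W ?f = phi_entropy \<Phi> (Z i) (\<zeta> i) g"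
        unfolding phi_entropy_def marginal[of g] marginal[of "\<lambda>a. \<Phi> (g a)"] ..
      \<comment> \<open>For \<open>j \<noteq> i\<close> an update of coordinate \<open>j\<close>
        does not change \<open>?f\<close>, so \<open>G\<close> is evaluated on the diagonal; for
        \<open>j = i\<close> only the marginal \<open>\<zeta> i\<close> is seen.\<close>
      have "coord_energy G {1..d} Z \<zeta> M ?f j = (if j = i then energy G (Z i) (\<zeta> i) (M i) g else 0)" for j
        unfolding coord_energy_def energy_def marginal[of "\<lambda>a. \<Sum>b\<in>Z i. M i a b * G (g a) (g b)", symmetric]
        by (simp add: G_refl expect_def)
      then have "energy G ?P ?W (product_generator d M) ?f = energy G (Z i) (\<zeta> i) (M i) g / real d"
        unfolding en using i by simp
      then show "real d * ?A * phi_entropy \<Phi> (Z i) (\<zeta> i) g \<le> energy G (Z i) (\<zeta> i) (M i) g"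
        using mult_left_mono[OF optimal_constant_le[OF fin gen pp f], of "real d"] d
        unfolding ent by (simp add: mult.assoc)
    qed
    then have "real d * ?A \<le> c"
      unfolding c_def using d by (intro Min.boundedI) auto
    then show ?thesis
      using d by (simp add: field_simps)
  qed
  ultimately show ?thesis
    by (simp add: c_def product_space_def product_weight_def[abs_def])
qed

end

subsection \<open>The Poincare and log-Sobolev cases\<close>

interpretation quadratic: entropy_functional UNIV "\<lambda>u. u\<^sup>2" "\<lambda>u v. (u - v)\<^sup>2 / 2"
proof
  show "\<exists>u\<in>UNIV. \<exists>v\<in>UNIV. u \<noteq> (v::real)"
    by (intro bexI[of _ 0] bexI[of _ 1]) auto
  fix u :: real
  \<comment> \<open>Slope from the derivative; the gap is \<open>(v - u)^2\<close>.\<close>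
  have "u\<^sup>2 + 2 * u * (v - u) < v\<^sup>2" if "v \<noteq> u" for v
  proof -
    have "0 < (v - u)\<^sup>2" using that by simp
    then show ?thesis by (simp add: power2_eq_square algebra_simps)
  qed
  then show "\<exists>p. \<forall>v\<in>UNIV. v \<noteq> u \<longrightarrow> u\<^sup>2 + p * (v - u) < v\<^sup>2"
    by blast
  fix v :: real
  \<comment> \<open>The coefficients are the partial derivatives of \<open>G\<close>; the gap is
    half the square of the change in \<open>u - v\<close>.\<close>
  have "(u - v)\<^sup>2 / 2 + (u - v) * (u' - u) + (v - u) * (v' - v) \<le> (u' - v')\<^sup>2 / 2" for u' v'
  proof -
    have "(u' - v')\<^sup>2 / 2 - ((u - v)\<^sup>2 / 2 + (u - v) * (u' - u) + (v - u) * (v' - v)) =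
        ((u' - v') - (u - v))\<^sup>2 / 2"
      by (simp add: power2_eq_square field_simps)
    then show ?thesis
      using zero_le_power2[of "(u' - v') - (u - v)"] by linarith
  qed
  then show "\<exists>p q. \<forall>u'\<in>UNIV. \<forall>v'\<in>UNIV. (u - v)\<^sup>2 / 2 + p * (u' - u) + q * (v' - v) \<le> (u' - v')\<^sup>2 / 2"
    by blast
qed auto

text \<open>The integrand of the Fisher information is homogeneous of degree one, so its supporting
  plane at \<open>(u, v)\<close> passes through the origin.\<close>

interpretation logarithmic: entropy_functional "{0<..}" "\<lambda>u. u * ln u"
  "\<lambda>u v. u * (v / u - 1 - ln (v / u))"
proof
  show "\<exists>u\<in>{0<..}. \<exists>v\<in>{0<..}. u \<noteq> (v::real)"
    by (intro bexI[of _ 1] bexI[of _ 2]) auto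
  show "u * (u / u - 1 - ln (u / u)) = 0" for u :: real
    by (cases "u = 0") auto
  fix u :: real assume u: "u \<in> {0<..}"
  \<comment> \<open>Slope from the derivative; after division by \<open>v\<close> this is the strict
    form of \<open>ln t \<le> t - 1\<close> at \<open>t = u / v\<close>.\<close>
  have "u * ln u + (ln u + 1) * (v - u) < v * ln v" if "v > 0" "v \<noteq> u" for v
  proof -
    have "ln (u / v) < u / v - 1"
      using ln_le_minus_one[of "u / v"] ln_eq_minus_one[of "u / v"] u that by force
    then have "v * ln (u / v) < v * (u / v - 1)"
      using that by simp
    then show ?thesis
      using u that by (simp add: ln_div algebra_simps)
  qed
  then show "\<exists>p. \<forall>v\<in>{0<..}. v \<noteq> u \<longrightarrow> u * ln u + p * (v - u) < v * ln v"
    by (intro exI[of _ "ln u + 1"]) auto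
  fix v :: real assume v: "v \<in> {0<..}"
  show "0 \<le> u * (v / u - 1 - ln (v / u))"
    using ln_le_minus_one[of "v / u"] u v by (intro mult_nonneg_nonneg) auto
  \<comment> \<open>The coefficients are the partial derivatives of
    \<open>v - u - u * ln (v / u)\<close>. The gap is \<open>u' * (t - 1 - ln t)\<close> with
    \<open>t = (u * v') / (v * u')\<close>.\<close>
  have "u * (v / u - 1 - ln (v / u)) + ln (u / v) * (u' - u) + (1 - u / v) * (v' - v) \<le>
      u' * (v' / u' - 1 - ln (v' / u'))" if "u' > 0" "v' > 0" for u' v'
  proof -
    have "u' * ln ((u * v') / (v * u')) \<le> u' * ((u * v') / (v * u') - 1)"
      using u v that by (intro mult_left_mono ln_le_minus_one) auto
    also have "\<dots> = u * v' / v - u'"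
      using that by (simp add: field_simps)
    finally have "u' * (ln u + ln v' - ln v - ln u') \<le> u * v' / v - u'"
      using u v that by (simp add: ln_div ln_mult algebra_simps)
    moreover have "u * (v / u - 1 - ln (v / u)) = v - u - u * (ln v - ln u)"
      "u' * (v' / u' - 1 - ln (v' / u')) = v' - u' - u' * (ln v' - ln u')"
      "(1 - u / v) * (v' - v) = v' - v - u * v' / v + u"
      using u v that by (auto simp: ln_div field_simps)
    ultimately show ?thesis
      using u v by (simp add: ln_div algebra_simps)
  qed
  then show "\<exists>p q. \<forall>u'\<in>{0<..}. \<forall>v'\<in>{0<..}.
      u * (v / u - 1 - ln (v / u)) + p * (u' - u) + q * (v' - v) \<le> u' * (v' / u' - 1 - ln (v' / u'))"
    by (intro exI[of _ "ln (u / v)"] exI[of _ "1 - u / v"]) auto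
qed auto

section \<open>Identification of the two constants with the abstract one\<close>

lemma alpha_gPI_eq:
  "alpha_gPI Z \<zeta> M = optimal_constant UNIV (\<lambda>u. u\<^sup>2) (\<lambda>u v. (u - v)\<^sup>2 / 2) Z \<zeta> M"
  by (simp add: alpha_gPI_def optimal_constant_def dirichlet_form_eq_energy vari_eq_phi_entropy)

text \<open>A density has mean 1, where \<open>u * ln u\<close> vanishes.\<close>

lemma rel_entropy_eq_phi_entropy:
  "f \<in> densities Z \<zeta> \<Longrightarrow> rel_entropy Z \<zeta> f = phi_entropy (\<lambda>u. u * ln u) Z \<zeta> f"
  by (simp add: densities_def rel_entropy_def phi_entropy_def expect_def)

text \<open>Both terms of the entropy acquire \<open>c * ln c * expect Z \<zeta> f\<close>, which
  cancels.\<close>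

lemma phi_entropy_log_scale:
  assumes "finite Z" "\<zeta> \<in> pos_prob Z" "c > 0" "\<And>z. z \<in> Z \<Longrightarrow> f z > 0"
  shows "phi_entropy (\<lambda>u. u * ln u) Z \<zeta> (\<lambda>z. c * f z) = c * phi_entropy (\<lambda>u. u * ln u) Z \<zeta> f"
proof -
  have "0 < expect Z \<zeta> f"
    using assms by (intro expect_pos)
  moreover have "expect Z \<zeta> (\<lambda>z. c * f z * ln (c * f z)) =
      expect Z \<zeta> (\<lambda>z. c * (ln c * f z + f z * ln (f z)))"
    using assms by (intro expect_cong) (auto simp: ln_mult algebra_simps)
  ultimately show ?thesis
    using assms(3) by (simp add: phi_entropy_def expect_cmult expect_add ln_mult algebra_simps)
qed

lemma fisher_info_scale:
  assumes "c \<noteq> 0"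
  shows "fisher_info Z \<zeta> (\<lambda>z. c * f z) M = c * fisher_info Z \<zeta> f M"
  using assms by (simp add: fisher_info_def sum_distrib_left mult_ac)

text \<open>Numerator and denominator are homogeneous of degree one, so dividing a positive function
  by its mean turns it into a density with the same quotient. A constant density equals its mean,
  hence 1, so both infima exclude the same functions.\<close>

lemma alpha_gLSI_eq:
  assumes "finite Z" "\<zeta> \<in> pos_prob Z"
  shows "alpha_gLSI Z \<zeta> M = optimal_constant {0<..} (\<lambda>u. u * ln u)
    (\<lambda>u v. u * (v / u - 1 - ln (v / u))) Z \<zeta> M"
proof -
  let ?\<Phi> = "\<lambda>u::real. u * ln u"
  let ?A = "{\<phi> \<in> densities Z \<zeta>. \<exists>z\<in>Z. \<phi> z \<noteq> 1}"
  let ?B = "{f \<in> Z \<rightarrow> {0<..}. \<not> f constant_on Z}"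
  \<comment> \<open>\<open>rel_entropy\<close> is not homogeneous; \<open>phi_entropy\<close> is,
    and it agrees with \<open>rel_entropy\<close> on densities.\<close>
  let ?q = "\<lambda>f. fisher_info Z \<zeta> f M / phi_entropy ?\<Phi> Z \<zeta> f"
  have "?q ` ?A = ?q ` ?B"
  proof
    have "?A \<subseteq> ?B"
    proof
      fix f assume f: "f \<in> ?A"
      have False if "f constant_on Z"
      proof -
        obtain c where c: "\<And>z. z \<in> Z \<Longrightarrow> f z = c"
          using \<open>f constant_on Z\<close> by (auto simp: constant_on_def)
        then have "expect Z \<zeta> f = c"
          using expect_const[OF assms(2)] by (simp cong: expect_cong)
        then show False using f c by (auto simp: densities_def)
      qed
      then show "f \<in> ?B" using f by (auto simp: densities_def)
    qed
    then show "?q ` ?A \<subseteq> ?q ` ?B" by blast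
    show "?q ` ?B \<subseteq> ?q ` ?A"
    proof
      fix r assume "r \<in> ?q ` ?B"
      then obtain f where f: "f \<in> Z \<rightarrow> {0<..}" "\<not> f constant_on Z" "r = ?q f" by auto
      define m where "m = expect Z \<zeta> f"
      have pos: "f z > 0" if "z \<in> Z" for z
        using Pi_mem[OF f(1) that] by simp
      have m: "m > 0"
        unfolding m_def using assms pos by (intro expect_pos)
      define \<phi> where "\<phi> = (\<lambda>z. (1 / m) * f z)"
      have "\<phi> \<in> densities Z \<zeta>"
        unfolding densities_def \<phi>_def mem_Collect_eq expect_cmult m_def[symmetric]
        using m pos by simp
      moreover have "\<exists>z\<in>Z. \<phi> z \<noteq> 1"
      proof -
        obtain z where "z \<in> Z" "f z \<noteq> m"
          using f(2) by (auto simp: constant_on_def)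
        then show ?thesis
          using m by (auto simp: \<phi>_def field_simps)
      qed
      moreover have "phi_entropy ?\<Phi> Z \<zeta> \<phi> = (1 / m) * phi_entropy ?\<Phi> Z \<zeta> f"
        unfolding \<phi>_def using m pos assms by (intro phi_entropy_log_scale) auto
      moreover have "fisher_info Z \<zeta> \<phi> M = (1 / m) * fisher_info Z \<zeta> f M"
        unfolding \<phi>_def using m by (intro fisher_info_scale) auto
      ultimately have "\<phi> \<in> ?A" "?q \<phi> = ?q f"
        using m by auto
      then show "r \<in> ?q ` ?A"
        unfolding f(3) by (intro rev_image_eqI[of \<phi>]) auto
    qed
  qed
  then have "Inf (?q ` ?A) = optimal_constant {0<..} ?\<Phi> (\<lambda>u v. u * (v / u - 1 - ln (v / u))) Z \<zeta> M"
    by (simp add: optimal_constant_def fisher_info_eq_energy)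
  moreover have "alpha_gLSI Z \<zeta> M = Inf (?q ` ?A)"
    unfolding alpha_gLSI_def by (intro arg_cong[of _ _ Inf] image_cong) (auto simp: rel_entropy_eq_phi_entropy)
  ultimately show ?thesis by simp
qed

subsection \<open>Positivity of the optimal constants\<close>

lemma square_increment_le_dirichlet_form:
  assumes "finite Z" "generator Z M" "irreducible_on Z M" "\<zeta> \<in> pos_prob Z" "x \<in> Z" "y \<in> Z"
  shows "\<exists>C\<ge>0. \<forall>f. (f x - f y)\<^sup>2 \<le> C * dirichlet_form Z \<zeta> f M"
proof -
  have "(x, y) \<in> {(u, v). u \<in> Z \<and> v \<in> Z \<and> M u v > 0}\<^sup>*"
    using assms by (simp add: irreducible_on_def)
  then show ?thesis
  proof (induction rule: rtrancl_induct)
    case base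
    show ?case by (intro exI[of _ 0]) auto
  next
    case (step u v)
    then obtain C where C: "C \<ge> 0" "\<And>f. (f x - f u)\<^sup>2 \<le> C * dirichlet_form Z \<zeta> f M"
      by blast
    have uv: "u \<in> Z" "v \<in> Z" "M u v > 0" "\<zeta> u > 0"
      using step.hyps(2) assms(4) by (auto simp: pos_prob_def)
    \<comment> \<open>The edge from \<open>u\<close> to \<open>v\<close> contributes one term to a
      sum of nonnegative terms; the factor 2 undoes the 1/2 in the Dirichlet form.\<close>
    have edge: "(f u - f v)\<^sup>2 \<le> (2 / (M u v * \<zeta> u)) * dirichlet_form Z \<zeta> f M" for f
    proof -
      have nn: "0 \<le> M z z' * \<zeta> z * (f z - f z')\<^sup>2" if "z \<in> Z" "z' \<in> Z" for z z'
        using assms(2,4) that by (cases "z = z'") (auto simp: generator_def pos_prob_def less_imp_le)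
      have "M u v * \<zeta> u * (f u - f v)\<^sup>2 \<le> (\<Sum>z'\<in>Z. M u z' * \<zeta> u * (f u - f z')\<^sup>2)"
        using assms(1) uv nn by (intro member_le_sum[of v Z "\<lambda>z'. M u z' * \<zeta> u * (f u - f z')\<^sup>2"]) auto
      also have "\<dots> \<le> (\<Sum>z\<in>Z. \<Sum>z'\<in>Z. M z z' * \<zeta> z * (f z - f z')\<^sup>2)"
        using assms(1) uv nn
        by (intro member_le_sum[of u Z "\<lambda>z. \<Sum>z'\<in>Z. M z z' * \<zeta> z * (f z - f z')\<^sup>2"] sum_nonneg) auto
      finally show ?thesis
        using uv by (simp add: dirichlet_form_def field_simps)
    qed
    have "(f x - f v)\<^sup>2 \<le> (2 * (C + 2 / (M u v * \<zeta> u))) * dirichlet_form Z \<zeta> f M" for f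
    proof -
      have "(f x - f v)\<^sup>2 \<le> 2 * ((f x - f u)\<^sup>2 + (f u - f v)\<^sup>2)"
        using zero_le_power2[of "(f x - f u) - (f u - f v)"] by (simp add: power2_eq_square algebra_simps)
      also have "\<dots> \<le> 2 * (C * dirichlet_form Z \<zeta> f M + (2 / (M u v * \<zeta> u)) * dirichlet_form Z \<zeta> f M)"
        using C(2) edge by (intro mult_left_mono add_mono) auto
      finally show ?thesis by (simp add: algebra_simps)
    qed
    moreover have "0 \<le> 2 * (C + 2 / (M u v * \<zeta> u))"
      using C(1) uv by simp
    ultimately show ?case by blast
  qed
qed

lemma expect_square_increment_le_dirichlet_form:
  assumes "finite Z" "generator Z M" "irreducible_on Z M" "\<zeta> \<in> pos_prob Z" "y \<in> Z"
  obtains C where "C > 0" "\<And>f. expect Z \<zeta> (\<lambda>x. (f x - f y)\<^sup>2) \<le> C * dirichlet_form Z \<zeta> f M"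
proof -
  obtain C where C: "\<And>x. x \<in> Z \<Longrightarrow> C x \<ge> 0"
    "\<And>x f. x \<in> Z \<Longrightarrow> (f x - f y)\<^sup>2 \<le> C x * dirichlet_form Z \<zeta> f M"
    using square_increment_le_dirichlet_form[OF assms(1-4) _ assms(5)] by metis
  have E: "expect Z \<zeta> (\<lambda>x. (f x - f y)\<^sup>2) \<le> expect Z \<zeta> C * dirichlet_form Z \<zeta> f M" for f
    using expect_mono[OF assms(4), of "\<lambda>x. (f x - f y)\<^sup>2" "\<lambda>x. C x * dirichlet_form Z \<zeta> f M"] C(2)
      expect_cmult[of Z \<zeta> "dirichlet_form Z \<zeta> f M" C]
    by (simp add: mult.commute)
  have C0: "0 \<le> expect Z \<zeta> C"
    using expect_mono[OF assms(4), of "\<lambda>_. 0" C] C(1) assms(4) by (simp add: expect_const)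
  have "0 \<le> dirichlet_form Z \<zeta> f M" for f
    using quadratic.energy_nonneg[OF assms(2,4)] by (simp add: dirichlet_form_eq_energy)
  \<comment> \<open>Adding 1 makes the constant strictly positive, so that it can be inverted
    later.\<close>
  then have "expect Z \<zeta> (\<lambda>x. (f x - f y)\<^sup>2) \<le> (expect Z \<zeta> C + 1) * dirichlet_form Z \<zeta> f M" for f
    using E[of f] by (simp add: distrib_right add_increasing2)
  then show ?thesis
    using C0 by (intro that[of "expect Z \<zeta> C + 1"]) auto
qed

text \<open>The mean is the best constant approximation in mean square; the excess is
  \<open>(expect Z \<zeta> f - c)^2\<close>.\<close>

lemma vari_le_expect_square:
  assumes "\<zeta> \<in> pos_prob Z"
  shows "vari Z \<zeta> f \<le> expect Z \<zeta> (\<lambda>z. (f z - c)\<^sup>2)"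
proof -
  have "expect Z \<zeta> (\<lambda>z. (f z - c)\<^sup>2) = expect Z \<zeta> (\<lambda>z. (f z)\<^sup>2 + ((- 2 * c) * f z + c\<^sup>2))"
    by (simp add: power2_eq_square algebra_simps)
  also have "\<dots> = vari Z \<zeta> f + (expect Z \<zeta> f - c)\<^sup>2"
    unfolding expect_add expect_cmult expect_const[OF assms] vari_def
    by (simp add: power2_eq_square algebra_simps)
  finally show ?thesis by simp
qed

lemma alpha_gPI_pos:
  assumes "finite Z" "card Z \<ge> 2" "generator Z M" "irreducible_on Z M" "\<zeta> \<in> pos_prob Z"
  shows "0 < alpha_gPI Z \<zeta> M"
proof -
  obtain y where y: "y \<in> Z"
    using assms(2) by fastforce
  obtain C where C: "C > 0" "\<And>f. expect Z \<zeta> (\<lambda>x. (f x - f y)\<^sup>2) \<le> C * dirichlet_form Z \<zeta> f M"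
    using expect_square_increment_le_dirichlet_form[OF assms(1,3-5) y] by blast
  have "vari Z \<zeta> f \<le> C * dirichlet_form Z \<zeta> f M" for f
    using vari_le_expect_square[OF assms(5)] C(2) by (rule order_trans)
  then have "1 / C \<le> alpha_gPI Z \<zeta> M"
    unfolding alpha_gPI_eq using C(1)
    by (intro quadratic.le_optimal_constant assms(1,2,5))
      (simp add: dirichlet_form_eq_energy vari_eq_phi_entropy field_simps)
  then show ?thesis
    using C(1) by (meson less_le_trans zero_less_divide_1_iff)
qed

text \<open>Apply \<open>ln t \<le> t - 1\<close> to \<open>t = sqrt (v / u)\<close>, using
  \<open>ln (v / u) = 2 * ln t\<close>. The factor 2 in front compensates the 1/2 in the Dirichlet
  form.\<close>

lemma fisher_info_ge_dirichlet_sqrt: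
  assumes "generator Z M" "\<zeta> \<in> pos_prob Z" "\<And>z. z \<in> Z \<Longrightarrow> f z > 0"
  shows "2 * dirichlet_form Z \<zeta> (\<lambda>z. sqrt (f z)) M \<le> fisher_info Z \<zeta> f M"
proof -
  have pt: "(sqrt u - sqrt v)\<^sup>2 \<le> u * (v / u - 1 - ln (v / u))" if "u > 0" "v > 0" for u v :: real
  proof -
    have "ln (v / u) = 2 * ln (sqrt (v / u))"
      using that by (simp add: ln_sqrt)
    also have "\<dots> \<le> 2 * (sqrt (v / u) - 1)"
      using that by (intro mult_left_mono ln_le_minus_one) auto
    finally have "u * ln (v / u) \<le> u * (2 * (sqrt (v / u) - 1))"
      using that by simp
    moreover have "u * sqrt (v / u) = sqrt u * sqrt v"
      using that by (simp add: real_sqrt_divide field_simps)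
    moreover have "(sqrt u - sqrt v)\<^sup>2 = u + v - 2 * (sqrt u * sqrt v)"
      using that by (simp add: power2_diff)
    ultimately show ?thesis
      using that by (simp add: algebra_simps)
  qed
  have "M z z' * \<zeta> z * (sqrt (f z) - sqrt (f z'))\<^sup>2 \<le>
      M z z' * \<zeta> z * f z * (f z' / f z - 1 - ln (f z' / f z))" if "z \<in> Z" "z' \<in> Z" for z z'
  proof (cases "z = z'")
    case True
    then show ?thesis using assms(3)[OF that(1)] by simp
  next
    case False
    then have "0 \<le> M z z' * \<zeta> z"
      using assms(1,2) that by (auto simp: generator_def pos_prob_def less_imp_le)
    then show ?thesis
      using mult_left_mono[OF pt[of "f z" "f z'"], of "M z z' * \<zeta> z"] assms(3) that
      by (simp add: mult.assoc)
  qed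
  then show ?thesis
    unfolding dirichlet_form_def fisher_info_def by (simp add: sum_mono)
qed

text \<open>Bound the logarithm by its tangent at the mean.\<close>

lemma phi_entropy_log_le_vari:
  assumes "finite Z" "\<zeta> \<in> pos_prob Z" "\<And>z. z \<in> Z \<Longrightarrow> f z > 0"
  shows "phi_entropy (\<lambda>u. u * ln u) Z \<zeta> f \<le> vari Z \<zeta> f / expect Z \<zeta> f"
proof -
  define m where "m = expect Z \<zeta> f"
  have m: "m > 0"
    unfolding m_def using assms by (intro expect_pos)
  have "expect Z \<zeta> (\<lambda>z. f z * ln (f z)) \<le> expect Z \<zeta> (\<lambda>z. (ln m - 1) * f z + (1 / m) * (f z)\<^sup>2)"
  proof (rule expect_mono[OF assms(2)])
    fix z assume "z \<in> Z"
    then have fz: "f z > 0" by (rule assms)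
    have "f z * ln (f z / m) \<le> f z * (f z / m - 1)"
      using fz m by (intro mult_left_mono ln_le_minus_one) auto
    then show "f z * ln (f z) \<le> (ln m - 1) * f z + (1 / m) * (f z)\<^sup>2"
      using fz m by (simp add: ln_div power2_eq_square algebra_simps)
  qed
  then show ?thesis
    unfolding expect_add expect_cmult phi_entropy_def vari_def
    using m by (simp add: power2_eq_square field_simps flip: m_def)
qed

text \<open>The entropy is at most variance over mean. Since \<open>f\<close> is at most its mean
  over the smallest weight, increments of \<open>f\<close> are bounded by those of
  \<open>sqrt f\<close> with a squared factor proportional to the mean; this cancels the denominator
  and leaves a constant independent of \<open>f\<close>.\<close>

lemma alpha_gLSI_pos:
  assumes "finite Z" "card Z \<ge> 2" "generator Z M" "irreducible_on Z M" "\<zeta> \<in> pos_prob Z"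
  shows "0 < alpha_gLSI Z \<zeta> M"
proof -
  obtain y where y: "y \<in> Z"
    using assms(2) by fastforce
  obtain C where C: "C > 0" "\<And>f. expect Z \<zeta> (\<lambda>x. (f x - f y)\<^sup>2) \<le> C * dirichlet_form Z \<zeta> f M"
    using expect_square_increment_le_dirichlet_form[OF assms(1,3-5) y] by blast
  define a where "a = Min (\<zeta> ` Z)"
  have "a \<in> \<zeta> ` Z"
    unfolding a_def using assms(1) y by (intro Min_in) auto
  then have a: "a > 0" "\<And>z. z \<in> Z \<Longrightarrow> a \<le> \<zeta> z"
    using assms(1,5) by (auto simp: a_def pos_prob_def)
  have bound: "phi_entropy (\<lambda>u. u * ln u) Z \<zeta> f \<le> (2 * C / a) * fisher_info Z \<zeta> f M"
    if "f \<in> Z \<rightarrow> {0<..}" for f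
  proof -
    have pos: "f z > 0" if "z \<in> Z" for z
      using Pi_mem[OF \<open>f \<in> Z \<rightarrow> {0<..}\<close> that] by simp
    define m where "m = expect Z \<zeta> f"
    have m: "m > 0"
      unfolding m_def using assms pos by (intro expect_pos)
    \<comment> \<open>The single term \<open>f z * \<zeta> z\<close> cannot exceed the whole sum
      \<open>m\<close>.\<close>
    have fm: "f z \<le> m / a" if "z \<in> Z" for z
    proof -
      have "f z * a \<le> f z * \<zeta> z"
        using a(2)[OF that] pos[OF that] by simp
      also have "\<dots> \<le> m"
        unfolding m_def expect_def using assms(1,5) that pos
        by (intro member_le_sum[of z Z "\<lambda>z. f z * \<zeta> z"]) (auto simp: pos_prob_def less_imp_le)
      finally show ?thesis using a(1) by (simp add: field_simps)
    qed
    have "vari Z \<zeta> f \<le> expect Z \<zeta> (\<lambda>z. (f z - f y)\<^sup>2)"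
      by (rule vari_le_expect_square[OF assms(5)])
    \<comment> \<open>Factor \<open>f z - f y\<close> as sum times difference of square roots; the
      squared sum is at most \<open>2 * (f z + f y)\<close>, hence at most
      \<open>4 * m / a\<close>.\<close>
    also have "\<dots> \<le> expect Z \<zeta> (\<lambda>z. (4 * m / a) * (sqrt (f z) - sqrt (f y))\<^sup>2)"
    proof (rule expect_mono[OF assms(5)])
      fix z assume z: "z \<in> Z"
      let ?s = "sqrt (f z)" and ?t = "sqrt (f y)"
      have sq: "?s\<^sup>2 = f z" "?t\<^sup>2 = f y"
        using pos[OF z] pos[OF y] by auto
      have "(?s + ?t)\<^sup>2 \<le> 2 * (?s\<^sup>2 + ?t\<^sup>2)"
        using zero_le_power2[of "?s - ?t"] by (simp add: power2_sum power2_diff del: real_sqrt_pow2)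
      also have "\<dots> \<le> 4 * m / a"
        using fm[OF z] fm[OF y] unfolding sq by simp
      finally have "(?s + ?t)\<^sup>2 * (?s - ?t)\<^sup>2 \<le> (4 * m / a) * (?s - ?t)\<^sup>2"
        by (rule mult_right_mono) simp
      moreover have "(f z - f y)\<^sup>2 = (?s + ?t)\<^sup>2 * (?s - ?t)\<^sup>2"
      proof -
        have "f z - f y = (?s + ?t) * (?s - ?t)"
          using square_diff_square_factored[of ?s ?t] sq by (simp add: power2_eq_square)
        then show ?thesis by (simp only: power_mult_distrib)
      qed
      ultimately show "(f z - f y)\<^sup>2 \<le> (4 * m / a) * (?s - ?t)\<^sup>2" by simp
    qed
    also have "\<dots> \<le> (4 * m / a) * (C * dirichlet_form Z \<zeta> (\<lambda>z. sqrt (f z)) M)"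
      unfolding expect_cmult using C(2)[of "\<lambda>z. sqrt (f z)"] m a by (intro mult_left_mono) auto
    also have "\<dots> \<le> (4 * m / a) * (C * (fisher_info Z \<zeta> f M / 2))"
      using fisher_info_ge_dirichlet_sqrt[OF assms(3,5), of f] pos C(1) m a by (intro mult_left_mono) auto
    \<comment> \<open>The constant is \<open>4 * m / a\<close> times \<open>C / 2\<close>, divided
      by \<open>m\<close>.\<close>
    finally have "vari Z \<zeta> f / m \<le> (2 * C / a) * fisher_info Z \<zeta> f M"
      using m a by (simp add: field_simps)
    then show ?thesis
      using phi_entropy_log_le_vari[OF assms(1,5), of f] pos by (simp add: m_def)
  qed
  have "1 / (2 * C / a) \<le> alpha_gLSI Z \<zeta> M"
    unfolding alpha_gLSI_eq[OF assms(1,5)]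
  proof (rule logarithmic.le_optimal_constant[OF assms(1,2,5)])
    fix f assume f: "f \<in> Z \<rightarrow> {0::real<..}"
    show "1 / (2 * C / a) * phi_entropy (\<lambda>u. u * ln u) Z \<zeta> f
        \<le> energy (\<lambda>u v. u * (v / u - 1 - ln (v / u))) Z \<zeta> M f"
      using bound[OF f] C(1) a(1) unfolding fisher_info_eq_energy[symmetric] by (simp add: field_simps)
  qed
  then show ?thesis
    using C(1) a(1) by (meson divide_pos_pos less_le_trans mult_pos_pos zero_less_numeral zero_less_one)
qed

section \<open>The inequalities with their optimal constants, and the product formula\<close>

lemma gPI_alpha_gPI:
  assumes "finite Z" "card Z \<ge> 2" "generator Z M" "irreducible_on Z M" "\<zeta> \<in> pos_prob Z"
  shows "gPI Z \<zeta> M (alpha_gPI Z \<zeta> M)"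
proof -
  have "alpha_gPI Z \<zeta> M * vari Z \<zeta> f \<le> dirichlet_form Z \<zeta> f M" for f
    unfolding alpha_gPI_eq vari_eq_phi_entropy dirichlet_form_eq_energy
    using assms by (intro quadratic.optimal_constant_le) auto
  then show ?thesis
    using alpha_gPI_pos[OF assms] by (simp add: gPI_def field_simps)
qed

lemma gLSI_alpha_gLSI:
  assumes "finite Z" "card Z \<ge> 2" "generator Z M" "irreducible_on Z M" "\<zeta> \<in> pos_prob Z"
  shows "gLSI Z \<zeta> M (alpha_gLSI Z \<zeta> M)"
proof -
  have "alpha_gLSI Z \<zeta> M * rel_entropy Z \<zeta> f \<le> fisher_info Z \<zeta> f M" if "f \<in> densities Z \<zeta>" for f
    unfolding alpha_gLSI_eq[OF assms(1,5)] rel_entropy_eq_phi_entropy[OF that] fisher_info_eq_energy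
    using assms that by (intro logarithmic.optimal_constant_le) (auto simp: densities_def)
  then show ?thesis
    using alpha_gLSI_pos[OF assms] by (simp add: gLSI_def field_simps)
qed

theorem proposition4p2:
  fixes d :: nat
    and Z :: "nat \<Rightarrow> 'a set"
    and M :: "nat \<Rightarrow> 'a \<Rightarrow> 'a \<Rightarrow> real"
    and \<zeta> :: "nat \<Rightarrow> 'a \<Rightarrow> real"
  assumes "d \<ge> 1"
    and "\<And>i. i \<in> {1..d} \<Longrightarrow> finite (Z i) \<and> card (Z i) \<ge> 2"
    and "\<And>i. i \<in> {1..d} \<Longrightarrow> generator (Z i) (M i) \<and> irreducible_on (Z i) (M i)"
    and "\<And>i. i \<in> {1..d} \<Longrightarrow> \<zeta> i \<in> pos_prob (Z i)"
    and "ZZ = product_space d Z"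
    and "\<zeta>\<zeta> = product_weight d \<zeta>"
    and "MM = product_generator d M"
  shows "\<zeta>\<zeta> \<in> pos_prob ZZ \<and>
    generator ZZ MM \<and> irreducible_on ZZ MM \<and>
    gPI ZZ \<zeta>\<zeta> MM (alpha_gPI ZZ \<zeta>\<zeta> MM) \<and>
    gLSI ZZ \<zeta>\<zeta> MM (alpha_gLSI ZZ \<zeta>\<zeta> MM) \<and>
    alpha_gPI ZZ \<zeta>\<zeta> MM = (1 / real d) * (MIN i\<in>{1..d}. alpha_gPI (Z i) (\<zeta> i) (M i)) \<and>
    alpha_gLSI ZZ \<zeta>\<zeta> MM = (1 / real d) * (MIN i\<in>{1..d}. alpha_gLSI (Z i) (\<zeta> i) (M i))"
proof -
  have Z: "finite (Z i)" "card (Z i) \<ge> 2" and M: "generator (Z i) (M i)" "irreducible_on (Z i) (M i)"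
    and \<zeta>: "\<zeta> i \<in> pos_prob (Z i)" if "i \<in> {1..d}" for i
    using assms(2-4)[OF that] by auto
  have ZZ: "finite ZZ" "card ZZ \<ge> 2"
    unfolding assms(5) product_space_def using Z
    by (intro finite_PiE card_PiE_ge_2 assms(1); auto)+
  have \<zeta>\<zeta>: "\<zeta>\<zeta> \<in> pos_prob ZZ"
    unfolding assms(5,6) product_space_def product_weight_def[abs_def]
    using Z \<zeta> by (intro pos_prob_PiE) auto
  have gen: "generator ZZ MM" and irr: "irreducible_on ZZ MM"
    unfolding assms(5,7) product_space_def
    using Z M by (intro generator_product irreducible_product; blast)+
  have "alpha_gPI ZZ \<zeta>\<zeta> MM = (1 / real d) * (MIN i\<in>{1..d}. alpha_gPI (Z i) (\<zeta> i) (M i))"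
    unfolding alpha_gPI_eq assms(5-7)
    using assms(1) Z M(1) \<zeta> by (intro quadratic.optimal_constant_product)
  \<comment> \<open>Unlike its Poincare counterpart, \<open>alpha_gLSI_eq\<close> has hypotheses,
    valid only for \<open>i\<close> in \<open>{1..d}\<close>; hence the rewriting takes place inside
    the image over this set.\<close>
  moreover have "(\<lambda>i. alpha_gLSI (Z i) (\<zeta> i) (M i)) ` {1..d} = (\<lambda>i. optimal_constant {0<..}
      (\<lambda>u. u * ln u) (\<lambda>u v. u * (v / u - 1 - ln (v / u))) (Z i) (\<zeta> i) (M i)) ` {1..d}"
    using Z(1) \<zeta> by (intro image_cong refl alpha_gLSI_eq)
  then have "alpha_gLSI ZZ \<zeta>\<zeta> MM = (1 / real d) * (MIN i\<in>{1..d}. alpha_gLSI (Z i) (\<zeta> i) (M i))"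
    unfolding alpha_gLSI_eq[OF ZZ(1) \<zeta>\<zeta>] unfolding assms(5-7)
    using logarithmic.optimal_constant_product[OF assms(1) Z M(1) \<zeta>] by simp
  ultimately show ?thesis
    using \<zeta>\<zeta> gen irr gPI_alpha_gPI[OF ZZ gen irr \<zeta>\<zeta>] gLSI_alpha_gLSI[OF ZZ gen irr \<zeta>\<zeta>] by simp
qed

end
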